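(* Let $(A,\prec_\lambda,\succ_\lambda,\cdot_\lambda,\alpha,\beta)$ be a BiHom-tridendriform conformal algebra. Then $(A,\prec_\lambda,\succ_\lambda,\cdot_\lambda,\alpha,\beta)$ is a BiHom-NS-conformal algebra (with $\vee_\lambda=\cdot_\lambda$).
   Context: All vector spaces, linear maps and tensor products are over $\mathbb{C}$; $\lambda,\mu$ are formal variables. For a $\mathbb{C}[\partial]$-module $A$ put $A[\lambda]=\mathbb{C}[\lambda]\otimes A$. A $\mathbb{C}$-bilinear map $A\otimes A\to A[\lambda]$, $p\otimes q\mapsto p\circ_\lambda q$, is conformal sesquilinear if $(\partial p)\circ_\lambda q=-\lambda(p\circ_\lambda q)$ and $p\circ_\lambda(\partial q)=(\partial+\lambda)(p\circ_\lambda q)$. Linear maps and products are extended coefficientwise to polynomials in $\lambda,\mu$; e.g. if $p\circ_\lambda q=\sum_i\lambda^i a_i$ then $(p\circ_\lambda q)\circ_{\lambda+\mu}r=\sum_i\lambda^i(a_i\circ_{\lambda+\mu}r)$. A map $\alpha$ is multiplicative for $\circ_\lambda$ if $\alpha(p\circ_\lambda q)=\alpha(p)\circ_\lambda\alpha(q)$. A BiHom-tridendriform conformal algebra $(A,\prec_\lambda,\succ_\lambda,\cdot_\lambda,\alpha,\beta)$ is a $\mathbb{C}[\partial]$-module $A$ with three conformal sesquilinear maps $\prec_\lambda,\succ_\lambda,\cdot_\lambda:A\otimes A\to A[\lambda]$ and commuting $\mathbb{C}$-linear maps $\alpha,\beta:A\to A$ commuting with $\partial$ and multiplicative for all three products,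 such that for all $p,q,r\in A$: $(p\prec_\lambda q)\prec_{\lambda+\mu}\beta(r)=\alpha(p)\prec_\lambda(q\prec_\mu r+q\succ_\mu r+q\cdot_\mu r)$; $(p\succ_\lambda q)\prec_{\lambda+\mu}\beta(r)=\alpha(p)\succ_\lambda(q\prec_\mu r)$; $\alpha(p)\succ_\lambda(q\succ_\mu r)=(p\prec_\lambda q+p\succ_\lambda q+p\cdot_\lambda q)\succ_{\lambda+\mu}\beta(r)$; $\alpha(p)\cdot_\lambda(q\succ_\mu r)=(p\prec_\lambda q)\cdot_{\lambda+\mu}\beta(r)$; $\alpha(p)\succ_\lambda(q\cdot_\mu r)=(p\succ_\lambda q)\cdot_{\lambda+\mu}\beta(r)$; $\alpha(p)\cdot_\lambda(q\prec_\mu r)=(p\cdot_\lambda q)\prec_{\lambda+\mu}\beta(r)$; $\alpha(p)\cdot_\lambda(q\cdot_\mu r)=(p\cdot_\lambda q)\cdot_{\lambda+\mu}\beta(r)$. A BiHom-NS-conformal algebra $(A,\prec_\lambda,\succ_\lambda,\vee_\lambda,\alpha,\beta)$ is a $\mathbb{C}[\partial]$-module $A$ with conformal sesquilinear maps $\prec_\lambda,\succ_\lambda,\vee_\lambda:A\otimes A\to A[\lambda]$ and commuting $\mathbb{C}$-linear maps $\alpha,\beta:A\to A$ commuting with $\partial$ and multiplicative for all three products, such that, with $p*_\lambda q=p\prec_\lambda q+p\succ_\lambda q+p\vee_\lambda q$, for all $p,q,r\in A$: $(p\prec_\lambda q)\prec_{\lambda+\mu}\beta(r)=\alpha(p)\prec_\lambda(q*_\mu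 r)$; $(p\succ_\lambda q)\prec_{\lambda+\mu}\beta(r)=\alpha(p)\succ_\lambda(q\prec_\mu r)$; $(p*_\lambda q)\succ_{\lambda+\mu}\beta(r)=\alpha(p)\succ_\lambda(q\succ_\mu r)$; $(p\vee_\lambda q)\prec_{\lambda+\mu}\beta(r)+(p*_\lambda q)\vee_{\lambda+\mu}\beta(r)=\alpha(p)\succ_\lambda(q\vee_\mu r)+\alpha(p)\vee_\lambda(q*_\mu r)$. *)

theory Defs
  imports Complex_Main "HOL-Computational_Algebra.Polynomial"
begin

text \<open>
  The \<open>\<complex>[\<partial>]\<close>-module \<open>A\<close> is the type \<open>'a\<close> with an action of \<open>complex poly\<close>, the polynomial
  variable acting as \<open>\<partial>\<close>.  The type \<open>'a poly\<close> is only used as the set of finitely supported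
  coefficient sequences, i.e. \<open>A[\<lambda>]\<close>.  The type \<open>'a poly poly\<close> is \<open>A[\<lambda>,\<mu>]\<close>, read as
  \<open>A[\<lambda>][\<mu>]\<close>: the outer variable is \<open>\<mu>\<close> and the inner variable is \<open>\<lambda>\<close>.
\<close>

definition cscale :: "(complex poly \<Rightarrow> 'a::ab_group_add \<Rightarrow> 'a) \<Rightarrow> complex \<Rightarrow> 'a \<Rightarrow> 'a"
  where "cscale act c a = act [:c:] a"

definition del :: "(complex poly \<Rightarrow> 'a::ab_group_add \<Rightarrow> 'a) \<Rightarrow> 'a \<Rightarrow> 'a"
  where "del act a = act [:0, 1:] a"

definition mult_lam :: "'a::ab_group_add poly poly \<Rightarrow> 'a poly poly"
  where "mult_lam F = map_poly (pCons 0) F"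

definition mult_mu :: "'a::ab_group_add poly poly \<Rightarrow> 'a poly poly"
  where "mult_mu F = pCons 0 F"

text \<open>Substitution of \<open>\<lambda> + \<mu>\<close> for the variable: \<open>\<Sum>\<^sub>j x\<^sup>j b\<^sub>j \<mapsto> \<Sum>\<^sub>j (\<lambda> + \<mu>)\<^sup>j b\<^sub>j\<close>.\<close>

definition subst_lam_mu :: "'a::ab_group_add poly \<Rightarrow> 'a poly poly"
  where "subst_lam_mu f =
    (\<Sum>j\<le>degree f. ((\<lambda>F. mult_lam F + mult_mu F) ^^ j) [:[:coeff f j:]:])"

text \<open>\<open>f(\<lambda>) \<circ>\<^bsub>\<lambda>+\<mu>\<^esub> r = \<Sum>\<^sub>i \<lambda>\<^sup>i (a\<^sub>i \<circ>\<^bsub>\<lambda>+\<mu>\<^esub> r)\<close> for \<open>f(\<lambda>) = \<Sum>\<^sub>i \<lambda>\<^sup>i a\<^sub>i\<close>.\<close>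

definition lprod ::
    "('a::ab_group_add \<Rightarrow> 'a \<Rightarrow> 'a poly) \<Rightarrow> 'a poly \<Rightarrow> 'a \<Rightarrow> 'a poly poly"
  where "lprod m f r = (\<Sum>i\<le>degree f. (mult_lam ^^ i) (subst_lam_mu (m (coeff f i) r)))"

text \<open>\<open>p \<circ>\<^sub>\<lambda> g(\<mu>) = \<Sum>\<^sub>j \<mu>\<^sup>j (p \<circ>\<^sub>\<lambda> c\<^sub>j)\<close> for \<open>g(\<mu>) = \<Sum>\<^sub>j \<mu>\<^sup>j c\<^sub>j\<close>.\<close>

definition rprod ::
    "('a::ab_group_add \<Rightarrow> 'a \<Rightarrow> 'a poly) \<Rightarrow> 'a \<Rightarrow> 'a poly \<Rightarrow> 'a poly poly"
  where "rprod m p g = map_poly (m p) g"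

definition conformal_sesquilinear ::
    "(complex poly \<Rightarrow> 'a::ab_group_add \<Rightarrow> 'a) \<Rightarrow> ('a \<Rightarrow> 'a \<Rightarrow> 'a poly) \<Rightarrow> bool"
  where "conformal_sesquilinear act m \<longleftrightarrow>
    (\<forall>p. Vector_Spaces.linear (cscale act) (\<lambda>c. map_poly (cscale act c)) (\<lambda>q. m p q)) \<and>
    (\<forall>q. Vector_Spaces.linear (cscale act) (\<lambda>c. map_poly (cscale act c)) (\<lambda>p. m p q)) \<and>
    (\<forall>p q. m (del act p) q = - pCons 0 (m p q)) \<and>
    (\<forall>p q. m p (del act q) = map_poly (del act) (m p q) + pCons 0 (m p q))"

definition multiplicative :: "('a::ab_group_add \<Rightarrow> 'a) \<Rightarrow> ('a \<Rightarrow> 'a \<Rightarrow> 'a poly) \<Rightarrow> bool"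
  where "multiplicative \<phi> m \<longleftrightarrow> (\<forall>p q. map_poly \<phi> (m p q) = m (\<phi> p) (\<phi> q))"

locale bihom_three_products =
  module act for act :: "complex poly \<Rightarrow> 'a::ab_group_add \<Rightarrow> 'a" +
  fixes prec succ dot :: "'a \<Rightarrow> 'a \<Rightarrow> 'a poly"
    and \<alpha> \<beta> :: "'a \<Rightarrow> 'a"
  assumes sesquilinear_prec: "conformal_sesquilinear act prec"
    and sesquilinear_succ: "conformal_sesquilinear act succ"
    and sesquilinear_dot: "conformal_sesquilinear act dot"
    and linear_alpha: "Vector_Spaces.linear (cscale act) (cscale act) \<alpha>"
    and linear_beta: "Vector_Spaces.linear (cscale act) (cscale act) \<beta>"
    and alpha_beta: "\<alpha> (\<beta> p) = \<beta> (\<alpha> p)"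
    and alpha_del: "\<alpha> (del act p) = del act (\<alpha> p)"
    and beta_del: "\<beta> (del act p) = del act (\<beta> p)"
    and alpha_mult: "multiplicative \<alpha> prec" "multiplicative \<alpha> succ" "multiplicative \<alpha> dot"
    and beta_mult: "multiplicative \<beta> prec" "multiplicative \<beta> succ" "multiplicative \<beta> dot"

locale bihom_tridendriform_conformal_algebra =
  bihom_three_products act prec succ dot \<alpha> \<beta>
  for act :: "complex poly \<Rightarrow> 'a::ab_group_add \<Rightarrow> 'a" and prec succ dot \<alpha> \<beta> +
  assumes prec_prec:
      "lprod prec (prec p q) (\<beta> r) = rprod prec (\<alpha> p) (prec q r + succ q r + dot q r)"
    and succ_prec:
      "lprod prec (succ p q) (\<beta> r) = rprod succ (\<alpha> p) (prec q r)"
    and succ_succ: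
      "rprod succ (\<alpha> p) (succ q r) = lprod succ (prec p q + succ p q + dot p q) (\<beta> r)"
    and dot_succ:
      "rprod dot (\<alpha> p) (succ q r) = lprod dot (prec p q) (\<beta> r)"
    and succ_dot:
      "rprod succ (\<alpha> p) (dot q r) = lprod dot (succ p q) (\<beta> r)"
    and dot_prec:
      "rprod dot (\<alpha> p) (prec q r) = lprod prec (dot p q) (\<beta> r)"
    and dot_dot:
      "rprod dot (\<alpha> p) (dot q r) = lprod dot (dot p q) (\<beta> r)"

definition star ::
    "('a::ab_group_add \<Rightarrow> 'a \<Rightarrow> 'a poly) \<Rightarrow> ('a \<Rightarrow> 'a \<Rightarrow> 'a poly) \<Rightarrow> ('a \<Rightarrow> 'a \<Rightarrow> 'a poly) \<Rightarrow>
      'a \<Rightarrow> 'a \<Rightarrow> 'a poly"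
  where "star prec succ vee p q = prec p q + succ p q + vee p q"

locale bihom_NS_conformal_algebra =
  bihom_three_products act prec succ vee \<alpha> \<beta>
  for act :: "complex poly \<Rightarrow> 'a::ab_group_add \<Rightarrow> 'a" and prec succ vee \<alpha> \<beta> +
  assumes prec_prec:
      "lprod prec (prec p q) (\<beta> r) = rprod prec (\<alpha> p) (star prec succ vee q r)"
    and succ_prec:
      "lprod prec (succ p q) (\<beta> r) = rprod succ (\<alpha> p) (prec q r)"
    and star_succ:
      "lprod succ (star prec succ vee p q) (\<beta> r) = rprod succ (\<alpha> p) (succ q r)"
    and vee_star:
      "lprod prec (vee p q) (\<beta> r) + lprod vee (star prec succ vee p q) (\<beta> r)
        = rprod succ (\<alpha> p) (vee q r) + rprod vee (\<alpha> p) (star prec succ vee q r)"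

end

theory Submission
  imports Defs
begin

text \<open>
  Once \<open>*\<close> is expanded, the first three NS axioms are tridendriform axioms (the third one with
  its sides exchanged).  The fourth is the sum of the four tridendriform axioms with \<open>\<cdot>\<close> on
  both sides, here written without the subscripts \<open>\<lambda>\<close>, \<open>\<mu>\<close>, \<open>\<lambda> + \<mu>\<close>:
  \<open>(p \<cdot> q) \<prec> \<beta>(r) = \<alpha>(p) \<cdot> (q \<prec> r)\<close>,
  \<open>(p \<prec> q) \<cdot> \<beta>(r) = \<alpha>(p) \<cdot> (q \<succ> r)\<close>,
  \<open>(p \<succ> q) \<cdot> \<beta>(r) = \<alpha>(p) \<succ> (q \<cdot> r)\<close> and
  \<open>(p \<cdot> q) \<cdot> \<beta>(r) = \<alpha>(p) \<cdot> (q \<cdot> r)\<close>.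
  To collect their terms into \<open>(p * q) \<cdot> \<beta>(r)\<close> and \<open>\<alpha>(p) \<cdot> (q * r)\<close>, the coefficientwise
  extensions of \<open>\<cdot>\<close> to polynomials must be additive in the polynomial argument.  For
  \<open>lprod\<close> this is not immediate, since it is a sum up to the degree of that argument,
  and the degree is not compatible with addition.
\<close>

text \<open>
  The degree bound is harmless: an additive map kills zero coefficients, so it may be replaced
  by a common bound for all the polynomials involved.
\<close>

lemma additive_sum_coeff_upto_degree:
  fixes H :: "nat \<Rightarrow> 'a::ab_group_add \<Rightarrow> 'b::ab_group_add"
  assumes H: "\<And>i. additive (H i)"
  shows "additive (\<lambda>f. \<Sum>i\<le>degree f. H i (coeff f i))"
proof
  fix f g :: "'a poly"
  define N where "N = max (degree f) (degree g)"
  have upto: "(\<Sum>i\<le>degree h. H i (coeff h i)) = (\<Sum>i\<le>N. H i (coeff h i))"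
    if "degree h \<le> N" for h :: "'a poly"
    using that
    by (intro sum.mono_neutral_left) (auto simp: coeff_eq_0 additive.zero[OF H])
  have "degree (f + g) \<le> N"
    by (simp add: N_def degree_add_le_max)
  moreover have "degree f \<le> N" "degree g \<le> N"
    by (auto simp: N_def)
  ultimately show "(\<Sum>i\<le>degree (f + g). H i (coeff (f + g) i))
      = (\<Sum>i\<le>degree f. H i (coeff f i)) + (\<Sum>i\<le>degree g. H i (coeff g i))"
    by (simp only: upto) (simp add: additive.add[OF H] sum.distrib)
qed

lemma additive_comp:
  assumes "additive f" "additive g"
  shows "additive (\<lambda>x. f (g x))"
  using assms by (simp add: additive_def)

lemma additive_funpow:
  fixes f :: "'a::ab_group_add \<Rightarrow> 'a"
  assumes "additive f"
  shows "additive (f ^^ n)"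
proof (induction n)
  case 0
  show ?case by (simp add: additive_def)
next
  case (Suc n)
  then show ?case using assms by (simp add: additive_def)
qed

lemma additive_map_poly:
  fixes f :: "'a::ab_group_add \<Rightarrow> 'b::ab_group_add"
  assumes "additive f"
  shows "additive (map_poly f)"
  using assms additive.zero[OF assms]
  by (intro additive.intro poly_eqI) (simp add: coeff_map_poly additive.add)

lemma additive_mult_lam: "additive (mult_lam :: 'a::ab_group_add poly poly \<Rightarrow> _)"
proof -
  have "additive (map_poly (pCons (0::'a)))"
    by (intro additive_map_poly additive.intro) simp
  then show ?thesis
    by (simp add: additive_def mult_lam_def)
qed

lemma additive_subst_lam_mu: "additive (subst_lam_mu :: 'a::ab_group_add poly \<Rightarrow> _)"
proof -
  have step: "additive (\<lambda>F :: 'a poly poly. mult_lam F + mult_mu F)"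
    by (rule additive.intro)
       (simp add: additive.add[OF additive_mult_lam] mult_mu_def algebra_simps)
  have const: "additive (\<lambda>a :: 'a. [:[:a:]:])"
    by (rule additive.intro) simp
  have "additive (\<lambda>f :: 'a poly.
      \<Sum>j\<le>degree f. ((\<lambda>F. mult_lam F + mult_mu F) ^^ j) [:[:coeff f j:]:])"
    by (intro additive_sum_coeff_upto_degree additive_comp[OF additive_funpow[OF step] const])
  then show ?thesis
    by (simp add: additive_def subst_lam_mu_def)
qed

lemma additive_lprod:
  fixes m :: "'a::ab_group_add \<Rightarrow> 'a \<Rightarrow> 'a poly"
  assumes "additive (\<lambda>p. m p r)"
  shows "additive (\<lambda>f. lprod m f r)"
  unfolding lprod_def
  by (intro additive_sum_coeff_upto_degree additive_comp[OF additive_funpow[OF additive_mult_lam]]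
      additive_comp[OF additive_subst_lam_mu] assms)

lemma additive_rprod:
  assumes "additive (m p)"
  shows "additive (rprod m p)"
  using additive_map_poly[OF assms] by (simp add: additive_def rprod_def)

lemma conformal_sesquilinear_additive:
  assumes "conformal_sesquilinear act m"
  shows "additive (\<lambda>p. m p q)" "additive (m p)"
  using assms
  by (auto simp: conformal_sesquilinear_def linear_iff_module_hom additive_def
      intro: module_hom.add)

theorem proposition2p15:
  fixes act :: "complex poly \<Rightarrow> 'a::ab_group_add \<Rightarrow> 'a"
    and prec succ dot :: "'a \<Rightarrow> 'a \<Rightarrow> 'a poly"
    and \<alpha> \<beta> :: "'a \<Rightarrow> 'a"
  assumes "bihom_tridendriform_conformal_algebra act prec succ dot \<alpha> \<beta>"
  shows "bihom_NS_conformal_algebra act prec succ dot \<alpha> \<beta>"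
proof -
  interpret bihom_tridendriform_conformal_algebra act prec succ dot \<alpha> \<beta>
    by (fact assms)
  note lprod_add = additive.add[OF additive_lprod[OF
        conformal_sesquilinear_additive(1)[OF sesquilinear_dot]]]
  note rprod_add = additive.add[OF additive_rprod[OF
        conformal_sesquilinear_additive(2)[OF sesquilinear_dot]]]
  show ?thesis
  proof unfold_locales
    fix p q r
    show "lprod prec (prec p q) (\<beta> r) = rprod prec (\<alpha> p) (star prec succ dot q r)"
      by (simp add: star_def prec_prec)
    show "lprod prec (succ p q) (\<beta> r) = rprod succ (\<alpha> p) (prec q r)"
      by (fact succ_prec)
    show "lprod succ (star prec succ dot p q) (\<beta> r) = rprod succ (\<alpha> p) (succ q r)"
      by (simp add: star_def succ_succ)
    show "lprod prec (dot p q) (\<beta> r) + lprod dot (star prec succ dot p q) (\<beta> r)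
        = rprod succ (\<alpha> p) (dot q r) + rprod dot (\<alpha> p) (star prec succ dot q r)"
      by (simp add: star_def lprod_add rprod_add dot_succ succ_dot dot_prec dot_dot)
  qed
qed

end
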